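(* Let $A, B \in \mathfrak{gl}(n,\mathbb{R})$, and consider the dynamical systems $\dot X = AX$ and $\dot Y = BY$ on $GL(n,\mathbb{R})$. If every generalized eigenvalue of $A$ and every generalized eigenvalue of $B$ has negative real part, then the flows $e^{At}$ and $e^{Bt}$ are topologically conjugate in $GL(n,\mathbb{R})$.
   Context: The flow $e^{At}$ on $GL(n,\mathbb{R})$ is $X\mapsto e^{At}X$ (matrix exponential and matrix product), the solution of $\dot X=AX$ with initial condition $X\in GL(n,\mathbb{R})$; similarly for $B$. Generalized eigenvalues are the (possibly complex) eigenvalues of the real matrix. Two flows $\Phi_t$, $\Psi_t$ on a topological space $M$ are topologically conjugate if there is a homeomorphism $h:M\to M$ with $h(\Phi_t(x))=\Psi_t(h(x))$ for all $t\in\mathbb{R}$, $x\in M$. *)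

theory Defs
  imports "HOL-Analysis.Analysis"
begin

definition GL :: "(real^'n^'n) set" where
  "GL = {X. invertible X}"

text \<open>The multiplication of the type \<open>real^'n^'n\<close> is componentwise, so the library's
  \<open>exp\<close> and \<open>^\<close> do not give the matrix exponential and matrix powers. The \<open>k\<close>-th matrix power
  is written below as the \<open>k\<close>-fold iterate of left multiplication by \<open>A\<close>, applied to the
  identity matrix \<open>mat 1\<close>.\<close>

definition matrix_exp :: "real^'n^'n \<Rightarrow> real^'n^'n" where
  "matrix_exp A = (\<Sum>k. (1 / fact k) *\<^sub>R ((**) A ^^ k) (mat 1))"

definition exp_flow :: "real^'n^'n \<Rightarrow> real \<Rightarrow> real^'n^'n \<Rightarrow> real^'n^'n" where
  "exp_flow A t X = matrix_exp (t *\<^sub>R A) ** X"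

text \<open>Eigenvalues are taken over \<open>\<complex>\<close>, via the complexification of the real matrix.\<close>

definition gen_eigenvalue :: "real^'n^'n \<Rightarrow> complex \<Rightarrow> bool" where
  "gen_eigenvalue A \<mu> \<longleftrightarrow>
     (\<exists>v :: complex^'n. v \<noteq> 0 \<and> map_matrix complex_of_real A *v v = \<mu> *s v)"

text \<open>The space \<open>M\<close> carries the subspace topology of the ambient type.\<close>

definition topologically_conjugate_on ::
  "'a::topological_space set \<Rightarrow> (real \<Rightarrow> 'a \<Rightarrow> 'a) \<Rightarrow> (real \<Rightarrow> 'a \<Rightarrow> 'a) \<Rightarrow> bool" where
  "topologically_conjugate_on M \<Phi> \<Psi> \<longleftrightarrow>
     (\<exists>h h'. homeomorphism M M h h' \<and> (\<forall>t. \<forall>x\<in>M. h (\<Phi> t x) = \<Psi> t (h x)))"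

end

theory Submission
  imports Defs "HOL-Computational_Algebra.Fundamental_Theorem_Algebra"
begin

text \<open>Since the eigenvalues of \<open>A\<close> have negative real part, \<open>trace A < 0\<close>, and
  \<open>det (e\<^sup>t\<^sup>A X) = e\<^bsup>t trace A\<^esup> det X\<close>. Hence each orbit in the general linear group meets the
  section \<open>\<bar>det X\<bar> = 1\<close> exactly once, and the same holds for \<open>B\<close>. The conjugacy is the identity
  on this section and maps \<open>e\<^sup>s\<^sup>A X\<^sub>0\<close> to \<open>e\<^sup>s\<^sup>B X\<^sub>0\<close>, where \<open>s = ln \<bar>det X\<bar> / trace A\<close> is read
  off from \<open>X = e\<^sup>s\<^sup>A X\<^sub>0\<close>.\<close>

section \<open>The matrix exponential\<close>

text \<open>Each row sum of absolute values is at most the sum over all entries, so each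
  multiplication by \<open>A\<close> costs at most this one factor. The bound permits comparison
  with the scalar exponential series.\<close>

lemma abs_iterate_matrix_mult_nth_le:
  fixes A :: "real^'n^'n"
  shows "\<bar>((**) A ^^ k) (mat 1) $ i $ j\<bar> \<le> (\<Sum>i\<in>UNIV. \<Sum>j\<in>UNIV. \<bar>A $ i $ j\<bar>) ^ k"
proof (induction k arbitrary: i j)
  case 0
  then show ?case by (simp add: mat_def)
next
  case (Suc k)
  let ?M = "\<Sum>i\<in>UNIV. \<Sum>j\<in>UNIV. \<bar>A $ i $ j\<bar>"
  have "\<bar>((**) A ^^ Suc k) (mat 1) $ i $ j\<bar>
      = \<bar>\<Sum>l\<in>UNIV. A $ i $ l * ((**) A ^^ k) (mat 1) $ l $ j\<bar>"
    by (simp add: matrix_matrix_mult_def)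
  also have "\<dots> \<le> (\<Sum>l\<in>UNIV. \<bar>A $ i $ l\<bar> * ?M ^ k)"
    by (rule order_trans[OF sum_abs]) (auto intro!: sum_mono mult_left_mono Suc.IH simp: abs_mult)
  also have "\<dots> = (\<Sum>l\<in>UNIV. \<bar>A $ i $ l\<bar>) * ?M ^ k"
    by (simp add: sum_distrib_right)
  also have "\<dots> \<le> ?M * ?M ^ k"
    by (intro mult_right_mono zero_le_power sum_nonneg member_le_sum) (auto intro: sum_nonneg)
  finally show ?case by simp
qed

lemma iterate_scaleR_matrix_mult:
  fixes A :: "real^'n^'n"
  shows "((**) (t *\<^sub>R A) ^^ k) (mat 1) = t ^ k *\<^sub>R ((**) A ^^ k) (mat 1)"
  by (induction k)
    (simp_all add: scalar_matrix_assoc[symmetric] matrix_scalar_ac mult.commute)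

lemma iterate_matrix_mult_commute:
  fixes A :: "real^'n^'n"
  shows "((**) A ^^ k) (mat 1) ** A = A ** ((**) A ^^ k) (mat 1)"
  by (induction k) (simp_all add: matrix_mul_assoc[symmetric])

lemma summable_matrix_exp_nth:
  fixes A :: "real^'n^'n"
  shows "summable (\<lambda>k. ((**) A ^^ k) (mat 1) $ i $ j / fact k * t ^ k)"
proof (rule summable_comparison_test')
  let ?M = "\<Sum>i\<in>UNIV. \<Sum>j\<in>UNIV. \<bar>A $ i $ j\<bar>"
  show "summable (\<lambda>k. (?M * \<bar>t\<bar>) ^ k /\<^sub>R fact k)"
    by (rule summable_exp_generic)
  show "norm (((**) A ^^ k) (mat 1) $ i $ j / fact k * t ^ k) \<le> (?M * \<bar>t\<bar>) ^ k /\<^sub>R fact k"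
    if "k \<ge> 0" for k
    using mult_right_mono[OF abs_iterate_matrix_mult_nth_le[of k A i j], of "\<bar>t\<bar> ^ k / fact k"]
    by (simp add: abs_mult power_abs power_mult_distrib field_simps)
qed

text \<open>Convergence of matrices is entrywise and \<open>t ^ k\<close> factors out of the k-th
  power. Each entry is thus an everywhere convergent real power series in \<open>t\<close>, to which
  termwise differentiation applies.\<close>

lemma matrix_exp_scaleR_nth:
  fixes A :: "real^'n^'n"
  shows "matrix_exp (t *\<^sub>R A) $ i $ j = (\<Sum>k. ((**) A ^^ k) (mat 1) $ i $ j / fact k * t ^ k)"
proof -
  have "(\<lambda>k. (1 / fact k) *\<^sub>R ((**) (t *\<^sub>R A) ^^ k) (mat 1)) sums
      (\<chi> i j. \<Sum>k. ((**) A ^^ k) (mat 1) $ i $ j / fact k * t ^ k)"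
    unfolding sums_def
  proof (intro vec_tendstoI)
    fix i j
    have "(\<lambda>k. ((**) A ^^ k) (mat 1) $ i $ j / fact k * t ^ k) sums
        (\<Sum>k. ((**) A ^^ k) (mat 1) $ i $ j / fact k * t ^ k)"
      by (rule summable_sums[OF summable_matrix_exp_nth])
    then show "(\<lambda>n. (\<Sum>k<n. (1 / fact k) *\<^sub>R ((**) (t *\<^sub>R A) ^^ k) (mat 1)) $ i $ j) \<longlonglongrightarrow>
        (\<chi> i j. \<Sum>k. ((**) A ^^ k) (mat 1) $ i $ j / fact k * t ^ k) $ i $ j"
      by (simp add: sums_def iterate_scaleR_matrix_mult mult.commute)
  qed
  then show ?thesis
    unfolding matrix_exp_def by (simp add: sums_iff)
qed

lemma matrix_exp_0 [simp]: "matrix_exp (0 :: real^'n^'n) = mat 1"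
proof -
  have "matrix_exp (0 *\<^sub>R (0 :: real^'n^'n)) $ i $ j = mat 1 $ i $ j" for i j
    unfolding matrix_exp_scaleR_nth powser_zero by simp
  then show ?thesis by (simp add: vec_eq_iff)
qed

lemma DERIV_matrix_exp_nth_right:
  fixes A :: "real^'n^'n"
  shows "((\<lambda>t. matrix_exp (t *\<^sub>R A) $ i $ j) has_field_derivative
    (matrix_exp (t *\<^sub>R A) ** A) $ i $ j) (at t)"
proof -
  define c where "c i j k = ((**) A ^^ k) (mat 1) $ i $ j / fact k" for i j k
  have sm: "summable (\<lambda>k. c i j k * t ^ k)" for i j t
    unfolding c_def by (rule summable_matrix_exp_nth)
  have "((**) A ^^ Suc k) (mat 1) $ i $ j = (\<Sum>l\<in>UNIV. ((**) A ^^ k) (mat 1) $ i $ l * A $ l $ j)"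
    for k
    using iterate_matrix_mult_commute[of k A]
    by (simp add: matrix_matrix_mult_def vec_eq_iff)
  \<comment> \<open>The factor \<open>k + 1\<close> from differentiation turns
    \<open>fact (k + 1)\<close> into \<open>fact k\<close>, and the extra power of \<open>A\<close>
    is split off on the right.\<close>
  then have dc: "diffs (c i j) = (\<lambda>k. \<Sum>l\<in>UNIV. c i l k * A $ l $ j)"
    by (simp add: diffs_def c_def fun_eq_iff flip: sum_divide_distrib del: of_nat_Suc funpow.simps)
  have "(\<Sum>k. diffs (c i j) k * t ^ k) = (\<Sum>k. \<Sum>l\<in>UNIV. c i l k * t ^ k * A $ l $ j)"
    by (simp add: dc sum_distrib_left mult_ac)
  also have "\<dots> = (\<Sum>l\<in>UNIV. (\<Sum>k. c i l k * t ^ k) * A $ l $ j)"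
    by (subst suminf_sum) (auto simp: suminf_mult2 sm intro!: summable_mult2)
  also have "\<dots> = (matrix_exp (t *\<^sub>R A) ** A) $ i $ j"
    by (simp add: matrix_matrix_mult_def matrix_exp_scaleR_nth c_def)
  finally have "(\<Sum>k. diffs (c i j) k * t ^ k) = (matrix_exp (t *\<^sub>R A) ** A) $ i $ j" .
  moreover have "matrix_exp (s *\<^sub>R A) $ i $ j = (\<Sum>k. c i j k * s ^ k)" for s
    unfolding c_def by (rule matrix_exp_scaleR_nth)
  ultimately show ?thesis
    using termdiffs_strong_converges_everywhere[OF sm, of i j t] by simp
qed

text \<open>\<open>A\<close> commutes with its powers, and the identity passes to the sum of the
  series entry by entry. The derivative of the exponential may therefore be written with
  \<open>A\<close> on either side.\<close>

lemma matrix_exp_commute: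
  fixes A :: "real^'n^'n"
  shows "matrix_exp (t *\<^sub>R A) ** A = A ** matrix_exp (t *\<^sub>R A)"
proof -
  have "(\<Sum>l\<in>UNIV. matrix_exp (t *\<^sub>R A) $ i $ l * A $ l $ j)
      = (\<Sum>l\<in>UNIV. A $ i $ l * matrix_exp (t *\<^sub>R A) $ l $ j)" for i j
  proof -
    define c where "c i j k = ((**) A ^^ k) (mat 1) $ i $ j / fact k * t ^ k" for i j k
    have sm: "summable (c i j)" for i j
      unfolding c_def by (rule summable_matrix_exp_nth)
    have "(\<Sum>l\<in>UNIV. c i l k * A $ l $ j) = (\<Sum>l\<in>UNIV. A $ i $ l * c l j k)" for k
    proof -
      have "(\<Sum>l\<in>UNIV. ((**) A ^^ k) (mat 1) $ i $ l * A $ l $ j)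
          = (\<Sum>l\<in>UNIV. A $ i $ l * ((**) A ^^ k) (mat 1) $ l $ j)"
        using iterate_matrix_mult_commute[of k A]
        by (simp add: matrix_matrix_mult_def vec_eq_iff)
      moreover have "(\<Sum>l\<in>UNIV. c i l k * A $ l $ j)
          = t ^ k / fact k * (\<Sum>l\<in>UNIV. ((**) A ^^ k) (mat 1) $ i $ l * A $ l $ j)"
        unfolding sum_distrib_left c_def by (rule sum.cong) auto
      moreover have "(\<Sum>l\<in>UNIV. A $ i $ l * c l j k)
          = t ^ k / fact k * (\<Sum>l\<in>UNIV. A $ i $ l * ((**) A ^^ k) (mat 1) $ l $ j)"
        unfolding sum_distrib_left c_def by (rule sum.cong) auto
      ultimately show ?thesis
        by simp
    qed
    then have "(\<Sum>k. \<Sum>l\<in>UNIV. c i l k * A $ l $ j) = (\<Sum>k. \<Sum>l\<in>UNIV. A $ i $ l * c l j k)"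
      by simp
    then have "(\<Sum>l\<in>UNIV. (\<Sum>k. c i l k) * A $ l $ j) = (\<Sum>l\<in>UNIV. A $ i $ l * (\<Sum>k. c l j k))"
      by (simp add: suminf_sum suminf_mult2[OF sm] suminf_mult[OF sm] sm summable_mult summable_mult2)
    then show ?thesis
      by (simp add: matrix_exp_scaleR_nth c_def)
  qed
  then show ?thesis
    by (simp add: matrix_matrix_mult_def vec_eq_iff)
qed

text \<open>With s fixed, the product rule in t gives two terms that differ only in sign and in the
  bracketing around \<open>A\<close>. The product is thus constant, and its value at t = 0 is the
  right-hand side. Both the inverse and the group law follow from this.\<close>

lemma matrix_exp_uminus_mult_add:
  fixes A :: "real^'n^'n"
  shows "matrix_exp ((- t) *\<^sub>R A) ** matrix_exp ((s + t) *\<^sub>R A) = matrix_exp (s *\<^sub>R A)"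
proof -
  let ?E = "\<lambda>t. matrix_exp (t *\<^sub>R A)"
  have "(?E (- t) ** ?E (s + t)) $ i $ j = (?E (- 0) ** ?E (s + 0)) $ i $ j" for i j
  proof (rule DERIV_isconst_all[rule_format, where f = "\<lambda>t. (?E (- t) ** ?E (s + t)) $ i $ j"])
    fix t
    have d1: "((\<lambda>t. ?E (- t) $ i $ l) has_field_derivative - (?E (- t) ** A) $ i $ l) (at t)" for l
      using DERIV_chain2[where g = uminus, OF DERIV_matrix_exp_nth_right[of A i l "- t"], of "-1" UNIV]
      by (simp add: DERIV_minus DERIV_ident)
    have d2: "((\<lambda>t. ?E (s + t) $ l $ j) has_field_derivative (A ** ?E (s + t)) $ l $ j) (at t)" for l
      using DERIV_chain2[where g = "(+) s", OF DERIV_matrix_exp_nth_right[of A l j "s + t"], of 1 UNIV]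
      using DERIV_add[OF DERIV_const[of s] DERIV_ident, of t UNIV]
      by (simp add: matrix_exp_commute)
    have "((\<lambda>t. \<Sum>l\<in>UNIV. ?E (- t) $ i $ l * ?E (s + t) $ l $ j) has_field_derivative
        (\<Sum>l\<in>UNIV. - (?E (- t) ** A) $ i $ l * ?E (s + t) $ l $ j
          + (A ** ?E (s + t)) $ l $ j * ?E (- t) $ i $ l)) (at t)"
      by (intro DERIV_sum DERIV_mult d1 d2)
    moreover have "(\<Sum>l\<in>UNIV. - (?E (- t) ** A) $ i $ l * ?E (s + t) $ l $ j
          + (A ** ?E (s + t)) $ l $ j * ?E (- t) $ i $ l)
        = (?E (- t) ** (A ** ?E (s + t))) $ i $ j - ((?E (- t) ** A) ** ?E (s + t)) $ i $ j"
      by (simp add: matrix_matrix_mult_def sum_subtractf mult.commute)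
    ultimately show "((\<lambda>t. (?E (- t) ** ?E (s + t)) $ i $ j) has_field_derivative 0) (at t)"
      by (simp add: matrix_mul_assoc) (simp add: matrix_matrix_mult_def)
  qed
  then show ?thesis
    by (simp add: vec_eq_iff)
qed

lemma matrix_exp_uminus_mult:
  fixes A :: "real^'n^'n"
  shows "matrix_exp ((- t) *\<^sub>R A) ** matrix_exp (t *\<^sub>R A) = mat 1"
  using matrix_exp_uminus_mult_add[of t A 0] by simp

lemma matrix_exp_add:
  fixes A :: "real^'n^'n"
  shows "matrix_exp ((s + t) *\<^sub>R A) = matrix_exp (s *\<^sub>R A) ** matrix_exp (t *\<^sub>R A)"
proof -
  \<comment> \<open>The second factor is expanded so that the exponentials at \<open>s\<close> and
    \<open>- s\<close> become adjacent and cancel.\<close>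
  have "matrix_exp (s *\<^sub>R A) ** matrix_exp (t *\<^sub>R A)
      = matrix_exp (s *\<^sub>R A) ** (matrix_exp ((- s) *\<^sub>R A) ** matrix_exp ((t + s) *\<^sub>R A))"
    by (simp only: matrix_exp_uminus_mult_add)
  also have "\<dots> = matrix_exp ((s + t) *\<^sub>R A)"
    using matrix_exp_uminus_mult[of "- s" A] by (simp add: matrix_mul_assoc add.commute)
  finally show ?thesis by simp
qed

lemma continuous_on_matrix_exp_scaleR [continuous_intros]:
  fixes A :: "real^'n^'n"
  assumes "continuous_on S f"
  shows "continuous_on S (\<lambda>x. matrix_exp (f x *\<^sub>R A))"
proof -
  have "continuous_on UNIV (\<lambda>t. \<chi> i j. matrix_exp (t *\<^sub>R A) $ i $ j)"
    by (intro continuous_on_vec_lambda DERIV_continuous_on)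
      (rule DERIV_matrix_exp_nth_right)
  then have "continuous_on UNIV (\<lambda>t. matrix_exp (t *\<^sub>R A))"
    by simp
  then show ?thesis
    using assms by (rule continuous_on_compose2) auto
qed

section \<open>Determinant and trace\<close>

text \<open>Jacobi's formula at the identity: in the differentiated Leibniz expansion only the
  identity permutation survives. It is stated over a general normed field because it serves both the
  real exponential and a complex pencil.\<close>

lemma DERIV_det_at_identity:
  fixes F :: "'a::real_normed_field \<Rightarrow> 'a^'n^'n"
  assumes "\<And>i j. ((\<lambda>x. F x $ i $ j) has_field_derivative D $ i $ j) (at a)" and "F a = mat 1"
  shows "((\<lambda>x. det (F x)) has_field_derivative trace D) (at a)"
proof -
  let ?d = "\<lambda>p. \<Sum>i\<in>UNIV. D $ i $ p i * (\<Prod>j\<in>UNIV - {i}. F a $ j $ p j)"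
  have "((\<lambda>x. det (F x)) has_field_derivative
      (\<Sum>p | p permutes (UNIV :: 'n set). of_int (sign p) * ?d p)) (at a)"
    unfolding det_def
    by (intro DERIV_sum DERIV_cmult has_field_derivative_prod assms(1))
  moreover have "?d p = 0" if p: "p permutes UNIV" and "p \<noteq> id" for p :: "'n \<Rightarrow> 'n"
  proof (intro sum.neutral ballI)
    fix i
    \<comment> \<open>A permutation other than the identity moves at least two points,
      \<open>k\<close> and \<open>p k\<close>. One of them differs from \<open>i\<close>, so an
      off-diagonal zero remains among the undifferentiated factors.\<close>
    obtain k where k: "p k \<noteq> k"
      using \<open>p \<noteq> id\<close> by (auto simp: fun_eq_iff)
    then have "p (p k) \<noteq> p k"
      using p by (metis permutes_inj injD)
    with k obtain j where "j \<noteq> i" "p j \<noteq> j"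
      by metis
    then have "(\<Prod>j\<in>UNIV - {i}. F a $ j $ p j) = 0"
      by (intro prod_zero) (auto simp: assms(2) mat_def intro!: bexI[of _ j])
    then show "D $ i $ p i * (\<Prod>j\<in>UNIV - {i}. F a $ j $ p j) = 0"
      by simp
  qed
  then have "(\<Sum>p | p permutes (UNIV :: 'n set). of_int (sign p) * ?d p)
      = (\<Sum>p\<in>{id}. of_int (sign p) * ?d p)"
    by (intro sum.mono_neutral_right) (auto simp: permutes_id)
  moreover have "\<dots> = trace D"
    by (simp add: trace_def sign_id assms(2) mat_def)
  ultimately show ?thesis by simp
qed

text \<open>Liouville's formula. The derivative at 0 is the trace, and multiplicativity of the
  determinant carries it to every t, giving g' = g * trace A. Then g times the inverse scalar
  exponential is constant.\<close>

lemma det_matrix_exp: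
  fixes A :: "real^'n^'n"
  shows "det (matrix_exp (t *\<^sub>R A)) = exp (t * trace A)"
proof -
  let ?g = "\<lambda>t. det (matrix_exp (t *\<^sub>R A))"
  have "(?g has_field_derivative trace A) (at 0)"
    by (rule DERIV_det_at_identity)
      (use DERIV_matrix_exp_nth_right[of A _ _ 0] in simp_all)
  then have "((\<lambda>h. ?g (h - t)) has_field_derivative trace A) (at t)" for t
    using DERIV_shift[of ?g "trace A" t "- t"] by simp
  then have "((\<lambda>h. ?g t * ?g (h - t)) has_field_derivative ?g t * trace A) (at t)" for t
    by (rule DERIV_cmult)
  moreover have "?g t * ?g (h - t) = ?g h" for t h
    using matrix_exp_add[of t "h - t" A] by (simp add: det_mul)
  ultimately have g: "(?g has_field_derivative ?g t * trace A) (at t)" for t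
    by simp
  have "?g t * exp (- (t * trace A)) = ?g 0 * exp (- (0 * trace A))"
    by (rule DERIV_isconst_all[rule_format])
      (auto intro!: derivative_eq_intros g simp: algebra_simps)
  then show ?thesis
    by (simp add: exp_minus field_simps)
qed

section \<open>Eigenvalues and the sign of the trace\<close>

lemma det_scale:
  fixes A :: "'a::comm_ring_1^'n^'n"
  shows "det (\<chi> i j. c * A $ i $ j) = c ^ CARD('n) * det A"
  using det_rows_mul[of "\<lambda>_. c" "\<lambda>i. A $ i"]
  by (simp add: vector_scalar_mult_def)

lemma singular_matrix_kernel:
  fixes A :: "'a::field^'n^'n"
  assumes "det A = 0"
  obtains v where "v \<noteq> 0" "A *v v = 0"
  using assms invertible_det_nz[of A] invertible_left_inverse[of A] matrix_left_invertible_ker[of A]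
  by blast

text \<open>The logarithmic derivative at \<open>0\<close> is minus the sum of the inverses of the roots.\<close>

lemma Re_log_deriv_poly_neg:
  fixes p :: "complex poly"
  assumes "\<And>r. poly p r = 0 \<Longrightarrow> Re r > 0"
  shows "Re (poly (pderiv p) 0 / poly p 0) \<le> 0"
    and "degree p > 0 \<Longrightarrow> Re (poly (pderiv p) 0 / poly p 0) < 0"
proof -
  have "Re (poly (pderiv p) 0 / poly p 0) \<le> 0 \<and>
      (degree p > 0 \<longrightarrow> Re (poly (pderiv p) 0 / poly p 0) < 0)"
    using assms
  proof (induction "degree p" arbitrary: p)
    case 0
    then show ?case by (auto elim!: degree_eq_zeroE simp: pderiv_pCons)
  next
    case (Suc n)
    then obtain r where r: "poly p r = 0"
      using fundamental_theorem_of_algebra[of p] by (metis constant_degree nat.distinct(1))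
    then obtain q where q: "p = [:- r, 1:] * q"
      by (metis dvdE poly_eq_0_iff_dvd)
    have "q \<noteq> 0"
      using Suc.hyps(2) q by auto
    then have dq: "degree q = n"
      using Suc.hyps(2) by (simp add: q degree_mult_eq del: mult_pCons_left)
    have q0: "poly q 0 \<noteq> 0"
      using Suc.prems[of 0] by (auto simp: q)
    have r0: "Re r > 0"
      using Suc.prems r by blast
    then have "r \<noteq> 0" by auto
    \<comment> \<open>The linear factor with root \<open>r\<close> contributes - 1 / r to the
      logarithmic derivative. Its real part is strictly negative, so the weak bound for
      \<open>q\<close> suffices even when \<open>q\<close> is constant.\<close>
    have "Re (poly (pderiv q) 0 / poly q 0) \<le> 0"
      using Suc.hyps(1)[of q] dq Suc.prems by (auto simp: q)
    moreover have "poly (pderiv p) 0 = poly q 0 - r * poly (pderiv q) 0"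
      unfolding q pderiv_mult by (simp add: pderiv_pCons)
    then have "poly (pderiv p) 0 / poly p 0 = poly (pderiv q) 0 / poly q 0 - 1 / r"
      using q0 \<open>r \<noteq> 0\<close> by (simp add: q field_simps)
    moreover have "Re (1 / r) > 0"
      using r0 \<open>r \<noteq> 0\<close> by (simp add: Re_divide sum_power2_gt_zero_iff complex_eq_iff)
    ultimately show ?case by simp
  qed
  then show "Re (poly (pderiv p) 0 / poly p 0) \<le> 0"
    and "degree p > 0 \<Longrightarrow> Re (poly (pderiv p) 0 / poly p 0) < 0"
    by auto
qed

text \<open>The polynomial q(z) = det (I + z C) has q(0) = 1 and q'(0) = trace C, so the trace is
  its logarithmic derivative at 0. A root z makes - 1 / z an eigenvalue, which forces Re z >
  0.\<close>

lemma trace_neg: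
  fixes A :: "real^'n^'n"
  assumes ev: "\<And>\<mu>. gen_eigenvalue A \<mu> \<Longrightarrow> Re \<mu> < 0"
  shows "trace A < 0"
proof -
  define C where "C = map_matrix complex_of_real A"
  define F where "F z = (\<chi> i j. (mat 1 :: complex^'n^'n) $ i $ j + z * C $ i $ j)" for z
  \<comment> \<open>The Leibniz expansion with linear polynomials as entries, so that the
    determinant becomes an object of type \<open>complex poly\<close>.\<close>
  define q where "q = (\<Sum>p | p permutes (UNIV :: 'n set). smult (of_int (sign p))
      (\<Prod>i\<in>UNIV. [:(mat 1 :: complex^'n^'n) $ i $ p i, C $ i $ p i:]))"
  have q: "poly q z = det (F z)" for z
    by (simp add: q_def det_def F_def poly_sum poly_prod)
  have F0: "F 0 = mat 1"
    by (simp add: F_def vec_eq_iff)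
  have "((\<lambda>z. det (F z)) has_field_derivative trace C) (at 0)"
    by (rule DERIV_det_at_identity)
      (auto simp: F0, auto simp: F_def intro!: derivative_eq_intros)
  then have "(poly q has_field_derivative trace C) (at 0)"
    by (simp add: q[abs_def])
  then have dq: "poly (pderiv q) 0 = trace C"
    by (rule DERIV_unique[OF poly_DERIV])
  have roots: "Re z > 0" if "poly q z = 0" for z
  proof -
    have "det (F z) = 0"
      using that by (simp add: q)
    then obtain v where v: "v \<noteq> 0" "F z *v v = 0"
      by (rule singular_matrix_kernel)
    have z: "z \<noteq> 0"
      using v by (auto simp: F0)
    have "F z *v v = v + z *s (C *v v)"
      by (simp add: F_def mat_def matrix_vector_mult_def vec_eq_iff distrib_right sum.distrib
          sum_distrib_left if_distrib[of "\<lambda>x. x * _"] mult.assoc cong: if_cong)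
    with v have "v + z *s (C *v v) = 0"
      by simp
    then have "C *v v = (- 1 / z) *s v"
      using z by (simp add: vec_eq_iff field_simps eq_neg_iff_add_eq_0)
    then have "gen_eigenvalue A (- 1 / z)"
      using v unfolding gen_eigenvalue_def C_def by blast
    then have "Re (- 1 / z) < 0"
      by (rule ev)
    then show ?thesis
      by (simp add: Re_divide zero_less_divide_iff divide_less_0_iff not_sum_power2_lt_zero)
  qed
  \<comment> \<open>If q were constantly 1, then det (z I + C) = z^n for z \<noteq> 0. Letting z
    tend to 0 gives det C = 0, as n is positive, so 0 would be an eigenvalue, contrary to the
    negative real parts.\<close>
  have "degree q > 0"
  proof (rule ccontr)
    assume "\<not> degree q > 0"
    then have q1: "poly q z = 1" for z
      using q[of 0] by (auto simp: F0 elim!: degree_eq_zeroE)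
    let ?G = "\<lambda>z. \<chi> i j. z * (mat 1 :: complex^'n^'n) $ i $ j + C $ i $ j"
    have G: "det (?G z) = z ^ CARD('n)" if "z \<noteq> 0" for z
    proof -
      have "?G z = (\<chi> i j. z * F (inverse z) $ i $ j)"
        using that by (simp add: F_def vec_eq_iff algebra_simps)
      then show ?thesis
        using q1[of "inverse z"] by (simp add: det_scale q)
    qed
    have "((\<lambda>z. det (?G z)) \<longlongrightarrow> det (?G 0)) (at 0)"
      unfolding det_def vec_lambda_beta by (intro tendsto_intros)
    moreover have "((\<lambda>z. det (?G z)) \<longlongrightarrow> 0 ^ CARD('n)) (at 0)"
    proof (rule Lim_transform_eventually)
      show "((\<lambda>z::complex. z ^ CARD('n)) \<longlongrightarrow> 0 ^ CARD('n)) (at 0)"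
        by (intro tendsto_intros)
      show "\<forall>\<^sub>F z in at 0. z ^ CARD('n) = det (?G z)"
        using G by (auto simp: eventually_at_filter)
    qed
    ultimately have "det (?G 0) = 0 ^ CARD('n)"
      by (intro tendsto_unique[of "at (0::complex)"]) auto
    then have "det C = 0"
      by simp
    then obtain v where "v \<noteq> 0" "C *v v = 0"
      by (rule singular_matrix_kernel)
    then have "gen_eigenvalue A 0"
      unfolding gen_eigenvalue_def C_def by auto
    then show False
      using ev by fastforce
  qed
  then have "Re (poly (pderiv q) 0 / poly q 0) < 0"
    using Re_log_deriv_poly_neg(2)[of q] roots by blast
  then have "Re (trace C) < 0"
    by (simp add: dq q F0)
  then show ?thesis
    by (simp add: trace_def C_def map_matrix_def)
qed

section \<open>The conjugacy\<close>

definition det_time :: "real^'n^'n \<Rightarrow> real^'n^'n \<Rightarrow> real" where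
  "det_time A X = ln \<bar>det X\<bar> / trace A"

definition section_conjugacy :: "real^'n^'n \<Rightarrow> real^'n^'n \<Rightarrow> real^'n^'n \<Rightarrow> real^'n^'n" where
  "section_conjugacy A B X = exp_flow B (det_time A X) (exp_flow A (- det_time A X) X)"

lemma exp_flow_add: "exp_flow A (s + t) X = exp_flow A s (exp_flow A t X)"
  by (simp add: exp_flow_def matrix_exp_add matrix_mul_assoc)

lemma exp_flow_0 [simp]: "exp_flow A 0 X = X"
  by (simp add: exp_flow_def)

lemma det_exp_flow: "det (exp_flow A t X) = exp (t * trace A) * det X"
  by (simp add: exp_flow_def det_mul det_matrix_exp)

lemma exp_flow_in_GL_iff: "exp_flow A t X \<in> GL \<longleftrightarrow> X \<in> GL"
  by (simp add: GL_def invertible_det_nz det_exp_flow)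

lemma det_time_exp_flow:
  assumes "X \<in> GL" "trace A \<noteq> 0"
  shows "det_time A (exp_flow A t X) = t + det_time A X"
  using assms
  by (simp add: det_time_def det_exp_flow abs_mult ln_mult GL_def invertible_det_nz field_simps)

lemma section_conjugacy_in_GL: "X \<in> GL \<Longrightarrow> section_conjugacy A B X \<in> GL"
  by (simp add: section_conjugacy_def exp_flow_in_GL_iff)

lemma det_time_section_conjugacy:
  assumes X: "X \<in> GL" and A: "trace A \<noteq> 0" and B: "trace B \<noteq> 0"
  shows "det_time B (section_conjugacy A B X) = det_time A X"
proof -
  let ?Y = "exp_flow A (- det_time A X) X"
  have "det_time A ?Y = 0"
    using det_time_exp_flow[OF X A] by simp
  \<comment> \<open>Time zero means \<bar>det\<bar> = 1, a condition that does not mention the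
    matrix: both flows share this section.\<close>
  then have "det_time B ?Y = 0"
    using A by (simp add: det_time_def)
  then show ?thesis
    using X B by (simp add: section_conjugacy_def det_time_exp_flow exp_flow_in_GL_iff)
qed

text \<open>The time read off from the image along \<open>B\<close> is the time already used along
  \<open>A\<close>, so the four flow maps cancel in pairs.\<close>

lemma section_conjugacy_inverse:
  assumes "X \<in> GL" "trace A \<noteq> 0" "trace B \<noteq> 0"
  shows "section_conjugacy B A (section_conjugacy A B X) = X"
  unfolding section_conjugacy_def[of B A] det_time_section_conjugacy[OF assms]
  by (simp add: section_conjugacy_def flip: exp_flow_add)

text \<open>Moving along the orbit by \<open>t\<close> keeps the section point and adds
  \<open>t\<close> to the time, which becomes an extra \<open>t\<close> of flow along
  \<open>B\<close>.\<close>

lemma section_conjugacy_exp_flow: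
  assumes "X \<in> GL" "trace A \<noteq> 0"
  shows "section_conjugacy A B (exp_flow A t X) = exp_flow B t (section_conjugacy A B X)"
  by (simp add: section_conjugacy_def det_time_exp_flow[OF assms] flip: exp_flow_add)

lemma continuous_on_matrix_mult:
  fixes f :: "'a::topological_space \<Rightarrow> real^'n^'m" and g :: "'a \<Rightarrow> real^'k^'n"
  assumes "continuous_on S f" "continuous_on S g"
  shows "continuous_on S (\<lambda>x. f x ** g x)"
  unfolding matrix_matrix_mult_def by (intro continuous_intros assms)

lemma continuous_on_section_conjugacy:
  assumes "trace A \<noteq> 0"
  shows "continuous_on GL (section_conjugacy A B)"
proof -
  have "continuous_on GL (\<lambda>X :: real^'n^'n. det X)"
    unfolding det_def by (intro continuous_intros)
  then have "continuous_on GL (det_time A)"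
    unfolding det_time_def using assms
    \<comment> \<open>The logarithm is continuous here because the determinant does not vanish on
      \<open>GL\<close>.\<close>
    by (intro continuous_intros) (auto simp: GL_def invertible_det_nz)
  then show ?thesis
    unfolding section_conjugacy_def exp_flow_def
    by (intro continuous_on_matrix_mult continuous_on_matrix_exp_scaleR continuous_intros)
qed

theorem theorem3p2:
  fixes A B :: "real^'n^'n"
  assumes "\<And>\<mu>. gen_eigenvalue A \<mu> \<Longrightarrow> Re \<mu> < 0"
    and "\<And>\<mu>. gen_eigenvalue B \<mu> \<Longrightarrow> Re \<mu> < 0"
  shows "topologically_conjugate_on GL (exp_flow A) (exp_flow B)"
proof -
  have tr: "trace A \<noteq> 0" "trace B \<noteq> 0"
    using trace_neg[of A] trace_neg[of B] assms by force+
  have "homeomorphism GL GL (section_conjugacy A B) (section_conjugacy B A)"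
    using tr
    by (intro homeomorphismI continuous_on_section_conjugacy)
      (auto simp: section_conjugacy_in_GL section_conjugacy_inverse)
  then show ?thesis
    unfolding topologically_conjugate_on_def
    using section_conjugacy_exp_flow tr by blast
qed

end
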